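(* For every integer $r > 1$, $\mu(r) = m(r)$.
   Context: For a positive integer $n$, the unitary Cayley graph $X_n = \mathrm{Cay}(\mathbb{Z}_n, U_n)$ has vertex set $\mathbb{Z}_n$, and $x,y$ are adjacent iff $x - y \in U_n$, the group of units of $\mathbb{Z}_n$. An induced cycle of length $k \geq 3$ in a graph is a sequence of $k$ distinct vertices $v_0, \dots, v_{k-1}$ such that $v_i$ and $v_j$ are adjacent if and only if $i - j \equiv \pm 1 \pmod k$. $M(n)$ is the length of the longest induced cycle in $X_n$, and $m(r) = \max_n M(n)$ over all $n$ with exactly $r$ distinct prime divisors. A complete $k$-partite graph is a graph whose vertex set is partitioned into $k$ nonempty parts, two vertices being adjacent iff they lie in different parts. The conjunction $G_1 \wedge G_2$ of graphs has vertex set $V(G_1) \times V(G_2)$, with $(v_1,v_2)$ adjacent to $(u_1,u_2)$ iff $v_1u_1 \in E(G_1)$ and $v_2u_2 \in E(G_2)$; iterated conjunctions $G_1 \wedge \cdots \wedge G_r$ are defined analogously. For a multiset $S = \{k_1, \dots, k_r\}$ of positive integers, $\mathcal{G}^S$ is the class of graphs $G_1 \wedge \cdots \wedge G_r$ with each $G_i$ complete $k_i$-partite. $\mu(r)$ is the maximum length of an induced cycle in any graph belonging to $\mathcal{G}^S$ for any multiset $S$ of $r$ positive integers. *)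

theory Defs
  imports
    "HOL-Number_Theory.Number_Theory"
    "HOL-Library.Multiset"
    "HOL-Library.Disjoint_Sets"
    "HOL-Library.Infinite_Typeclass"
begin

section \<open>Graphs and induced cycles\<close>

text \<open>Only the restriction of \<open>adj\<close> to \<open>verts\<close> is meaningful.\<close>

record 'v graph =
  verts :: "'v set"
  adj :: "'v \<Rightarrow> 'v \<Rightarrow> bool"

definition induced_cycle :: "'v graph \<Rightarrow> 'v list \<Rightarrow> bool" where
  "induced_cycle G vs \<longleftrightarrow>
     length vs \<ge> 3 \<and> distinct vs \<and> set vs \<subseteq> verts G \<and>
     (\<forall>i < length vs. \<forall>j < length vs.
        adj G (vs ! i) (vs ! j) \<longleftrightarrow>
          [int i - int j = 1] (mod int (length vs)) \<or>
          [int i - int j = - 1] (mod int (length vs)))"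

definition induced_cycle_lengths :: "'v graph \<Rightarrow> nat set" where
  "induced_cycle_lengths G = {length vs | vs. induced_cycle G vs}"

text \<open>\<open>Max\<close> on a set of naturals is a genuine maximum exactly under this condition.\<close>

definition has_max :: "nat set \<Rightarrow> bool" where
  "has_max A \<longleftrightarrow> finite A \<and> A \<noteq> {}"


section \<open>Unitary Cayley graphs\<close>

definition cayley_graph :: "('a, 'b) ring_scheme \<Rightarrow> 'a set \<Rightarrow> 'a graph" where
  "cayley_graph R C = \<lparr>verts = carrier R, adj = (\<lambda>x y. x \<ominus>\<^bsub>R\<^esub> y \<in> C)\<rparr>"

definition unitary_cayley :: "nat \<Rightarrow> int graph" where
  "unitary_cayley n = cayley_graph (residue_ring (int n)) (Units (residue_ring (int n)))"

definition M_fun :: "nat \<Rightarrow> nat" where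
  "M_fun n = Max (induced_cycle_lengths (unitary_cayley n))"

definition m_values :: "nat \<Rightarrow> nat set" where
  "m_values r = {M_fun n | n. n > 0 \<and> card (prime_factors n) = r}"

definition m_fun :: "nat \<Rightarrow> nat" where
  "m_fun r = Max (m_values r)"


section \<open>Conjunctions of complete multipartite graphs\<close>

definition complete_multipartite :: "nat \<Rightarrow> 'v graph \<Rightarrow> bool" where
  "complete_multipartite k G \<longleftrightarrow>
     (\<exists>P. partition_on (verts G) P \<and> finite P \<and> card P = k \<and>
          (\<forall>x \<in> verts G. \<forall>y \<in> verts G. adj G x y \<longleftrightarrow> \<not> (\<exists>p \<in> P. x \<in> p \<and> y \<in> p)))"

text \<open>The vertices of \<open>G\<^sub>1 \<and> \<dots> \<and> G\<^sub>r\<close> are \<open>r\<close>-tuples, represented as lists.\<close>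

definition conj_graph :: "'v graph list \<Rightarrow> 'v list graph" where
  "conj_graph Gs =
     \<lparr>verts = {vs. length vs = length Gs \<and> (\<forall>i < length Gs. vs ! i \<in> verts (Gs ! i))},
      adj = (\<lambda>vs us. \<forall>i < length Gs. adj (Gs ! i) (vs ! i) (us ! i))\<rparr>"

definition conj_class :: "nat multiset \<Rightarrow> 'v list graph set" where
  "conj_class S =
     {conj_graph Gs | Gs. \<exists>ks. mset ks = S \<and> list_all2 complete_multipartite ks Gs}"

text \<open>
  HOL cannot quantify over all types inside a definition, so the type \<open>'v\<close> from which the
  vertices of the factors are taken is a parameter of \<open>\<mu>\<close>.  Every graph (of any
  cardinality) lives on some sufficiently large \<open>'v\<close>.
\<close>

definition mu_values :: "'v itself \<Rightarrow> nat \<Rightarrow> nat set" where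
  "mu_values T r =
     {l. \<exists>S. size S = r \<and> (\<forall>k \<in># S. k > 0) \<and>
           (\<exists>G \<in> (conj_class S :: 'v list graph set). l \<in> induced_cycle_lengths G)}"

definition mu :: "'v itself \<Rightarrow> nat \<Rightarrow> nat" where
  "mu T r = Max (mu_values T r)"

end

theory Submission
  imports Defs "HOL-Library.Countable"
begin

text \<open>
  Both graph classes encode an induced \<open>k\<close>-cycle by the same data: \<open>r\<close> vertex colourings of
  \<open>{0..<k}\<close> such that two indices differ in all \<open>r\<close> colours exactly when they are cyclically
  adjacent.  For the unitary Cayley graph the colours are the residues modulo the prime divisors
  of \<open>n\<close>, for a conjunction of complete multipartite graphs they are the parts.  Hence every
  cycle length of a unitary Cayley graph occurs in a conjunction.  Conversely, only finitely many
  colours matter, so once all primes exceed \<open>k\<close> the Chinese remainder theorem realises the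
  colourings; the vertices are automatically distinct when \<open>k \<ge> 5\<close>, which is no restriction
  for the maximum because a 6-cycle always exists for \<open>r > 1\<close>.  The maxima exist because the
  edges at indices \<open>3i, 3i+1\<close> form a cross family in the style of Bollobas' set-pair theorem,
  whose size is bounded in terms of \<open>r\<close>.
\<close>

section \<open>Cyclic adjacency and colourings that encode cycles\<close>

definition cyclic_adj :: "nat \<Rightarrow> nat \<Rightarrow> nat \<Rightarrow> bool" where
  "cyclic_adj k i j \<longleftrightarrow>
     [int i - int j = 1] (mod int k) \<or> [int i - int j = - 1] (mod int k)"

text \<open>Distinctness of the colour vectors is not demanded, since different vertices of a
  conjunction may lie in the same parts throughout; on a cycle this can happen only for
  \<open>k = 4\<close>.\<close>

definition cycle_colouring :: "nat \<Rightarrow> 't set \<Rightarrow> (nat \<Rightarrow> 't \<Rightarrow> 'c) \<Rightarrow> bool" where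
  "cycle_colouring k I c \<longleftrightarrow> k \<ge> 3 \<and>
     (\<forall>i<k. \<forall>j<k. (\<forall>t\<in>I. c i t \<noteq> c j t) \<longleftrightarrow> cyclic_adj k i j)"

lemma induced_cycle_iff:
  "induced_cycle G vs \<longleftrightarrow> length vs \<ge> 3 \<and> distinct vs \<and> set vs \<subseteq> verts G \<and>
     (\<forall>i<length vs. \<forall>j<length vs.
        adj G (vs ! i) (vs ! j) \<longleftrightarrow> cyclic_adj (length vs) i j)"
  by (simp add: induced_cycle_def cyclic_adj_def)

lemma cyclic_adj_succ: "cyclic_adj k i (Suc i mod k)"
proof -
  have "[int i - int (Suc i mod k) = int i - int (Suc i)] (mod int k)"
    by (intro cong_diff) (auto simp: cong_def zmod_int)
  then show ?thesis by (simp add: cyclic_adj_def)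
qed

lemma cyclic_adj_pred: "0 < k \<Longrightarrow> cyclic_adj k i ((i + (k - 1)) mod k)"
proof -
  assume "0 < k"
  have "[int i - int ((i + (k - 1)) mod k) = int i - int (i + (k - 1))] (mod int k)"
    by (intro cong_diff) (auto simp: cong_def zmod_int)
  also have "int i - int (i + (k - 1)) = 1 - int k" using \<open>0 < k\<close> by (simp add: of_nat_diff)
  also have "[1 - int k = 1] (mod int k)" by (simp add: cong_def)
  finally show ?thesis by (simp add: cyclic_adj_def)
qed

text \<open>If \<open>i + 1\<close> and \<open>i - 1\<close> are both neighbours of some
  \<open>j\<close> different from \<open>i\<close>, then \<open>i + 1\<close> is
  \<open>j - 1\<close> and \<open>i - 1\<close> is \<open>j + 1\<close> modulo \<open>k\<close>, so
  \<open>k\<close> divides 4. Opposite vertices of a 4-cycle show that the bound is sharp.\<close>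

lemma cyclic_adj_same_neighbours:
  assumes "k \<ge> 5" "i < k" "j < k"
    and same: "\<And>l. l < k \<Longrightarrow> cyclic_adj k i l \<longleftrightarrow> cyclic_adj k j l"
  shows "i = j"
proof (rule ccontr)
  assume "i \<noteq> j"
  then have ij: "\<not> [int i = int j] (mod int k)"
    using assms(2,3) by (auto simp: cong_int_iff dest: cong_less_modulus_unique_nat)
  have nd: "\<not> int k dvd int i - int j" using ij by (simp add: cong_iff_dvd_diff)
  define s where "s = Suc i mod k"
  define p where "p = (i + (k - 1)) mod k"
  have less: "s < k" "p < k" using assms(1) by (auto simp: s_def p_def)
  have s: "[int s = int i + 1] (mod int k)"
    by (auto simp: s_def cong_def zmod_int add.commute)
  have "[int p = int i + (int k - 1)] (mod int k)"
    using assms(1) by (auto simp: p_def cong_def zmod_int of_nat_diff algebra_simps)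
  also have "[int i + (int k - 1) = int i - 1] (mod int k)"
    by (simp add: cong_iff_dvd_diff)
  finally have p: "[int p = int i - 1] (mod int k)" .
  have "cyclic_adj k j s" using same less cyclic_adj_succ s_def by metis
  then have 1: "int k dvd int i - int j + 2"
  proof -
    assume "cyclic_adj k j s"
    then have "int k dvd int j - int s - 1 \<or> int k dvd int j - int s + 1"
      by (auto simp: cyclic_adj_def cong_iff_dvd_diff)
    moreover have "int k dvd int s - (int i + 1)" using s by (simp add: cong_iff_dvd_diff)
    ultimately have "int k dvd (int j - int s - 1) + (int s - (int i + 1)) \<or>
        int k dvd (int j - int s + 1) + (int s - (int i + 1))"
      using dvd_add by blast
    then have "int k dvd - (int i - int j + 2) \<or> int k dvd - (int i - int j)"
      by (simp add: algebra_simps)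
    then show ?thesis using nd by (metis dvd_minus_iff)
  qed
  have "cyclic_adj k j p" using same less cyclic_adj_pred p_def assms(1)
    by (metis gr0I not_numeral_le_zero)
  then have 2: "int k dvd int i - int j - 2"
  proof -
    assume "cyclic_adj k j p"
    then have "int k dvd int j - int p - 1 \<or> int k dvd int j - int p + 1"
      by (auto simp: cyclic_adj_def cong_iff_dvd_diff)
    moreover have "int k dvd int p - (int i - 1)" using p by (simp add: cong_iff_dvd_diff)
    ultimately have "int k dvd (int j - int p - 1) + (int p - (int i - 1)) \<or>
        int k dvd (int j - int p + 1) + (int p - (int i - 1))"
      using dvd_add by blast
    then have "int k dvd - (int i - int j - 2) \<or> int k dvd - (int i - int j)"
      by (auto simp: algebra_simps)
    then show ?thesis using nd by (metis dvd_minus_iff)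
  qed
  from dvd_diff[OF 1 2] have "int k dvd 4" by simp
  then have "int k \<le> 4" by (rule zdvd_imp_le) simp
  then show False using assms(1) by simp
qed

text \<open>Indices with equal colours on \<open>I\<close> have the same cyclic neighbours. This
  supplies distinct vertices when a cycle is built from colours alone.\<close>

lemma cycle_colouring_distinct:
  assumes "cycle_colouring k I c" "k \<ge> 5" "i < k" "j < k" "\<forall>t\<in>I. c i t = c j t"
  shows "i = j"
proof (rule cyclic_adj_same_neighbours[OF assms(2-4)])
  fix l assume "l < k"
  have "(\<forall>t\<in>I. c i t \<noteq> c l t) \<longleftrightarrow> (\<forall>t\<in>I. c j t \<noteq> c l t)" using assms(5) by simp
  then show "cyclic_adj k i l \<longleftrightarrow> cyclic_adj k j l"
    using assms \<open>l < k\<close> unfolding cycle_colouring_def by blast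
qed


section \<open>Boundedness\<close>

text \<open>The recursion mirrors the induction below: one fixed member, and for each of the
  \<open>Suc n\<close> coordinates a subfamily living on \<open>n\<close> coordinates. It solves to
  the sum of n!/k! over k \<le> n.\<close>

fun cross_bound :: "nat \<Rightarrow> nat" where
  "cross_bound 0 = 1"
| "cross_bound (Suc n) = Suc (Suc n * cross_bound n)"

text \<open>Every \<open>b j\<close> with \<open>j \<noteq> i\<close> meets the fixed vector \<open>a i\<close>; on those meeting it in a
  given coordinate \<open>t\<close>, all \<open>b j t\<close> coincide, so \<open>t\<close> never witnesses an agreement among them
  and can be dropped.\<close>

lemma card_cross_family_le:
  fixes a b :: "'j \<Rightarrow> 't \<Rightarrow> 'c"
  assumes "finite I" "finite J"
    and "\<And>j t. j \<in> J \<Longrightarrow> t \<in> I \<Longrightarrow> a j t \<noteq> b j t"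
    and "\<And>i j. i \<in> J \<Longrightarrow> j \<in> J \<Longrightarrow> i \<noteq> j \<Longrightarrow> \<exists>t\<in>I. a i t = b j t"
  shows "card J \<le> cross_bound (card I)"
  using assms
proof (induction "card I" arbitrary: I J)
  case 0
  then have "I = {}" by simp
  then have "\<forall>i\<in>J. \<forall>j\<in>J. i = j" using 0(5) by blast
  then have "card J \<le> 1" using card_le_Suc0_iff_eq[OF 0(3)] by simp
  then show ?case by (simp add: \<open>I = {}\<close>)
next
  case (Suc n)
  show ?case
  proof (cases "J = {}")
    case False
    then obtain i where i: "i \<in> J" by blast
    define K where "K t = {j \<in> J. b j t = a i t}" for t
    have K: "card (K t) \<le> cross_bound n" if t: "t \<in> I" for t
    proof -
      have n: "n = card (I - {t})" using Suc.hyps(2) Suc.prems(1) t by simp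
      show ?thesis
        unfolding n
      proof (rule Suc.hyps(1)[OF n])
        show "finite (I - {t})" "finite (K t)" using Suc.prems by (auto simp: K_def)
        show "a j s \<noteq> b j s" if "j \<in> K t" "s \<in> I - {t}" for j s
          using that Suc.prems(3) by (auto simp: K_def)
        show "\<exists>s\<in>I - {t}. a j s = b l s" if jl: "j \<in> K t" "l \<in> K t" "j \<noteq> l" for j l
        proof -
          obtain s where s: "s \<in> I" "a j s = b l s" using Suc.prems(4)[of j l] jl by (auto simp: K_def)
          have "a j t \<noteq> b l t" using Suc.prems(3)[of j t] jl t by (auto simp: K_def)
          with s show ?thesis by auto
        qed
      qed
    qed
    have "J \<subseteq> insert i (\<Union>t\<in>I. K t)"
    proof
      fix j assume j: "j \<in> J"
      show "j \<in> insert i (\<Union>t\<in>I. K t)"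
      proof (cases "j = i")
        case False
        then obtain t where "t \<in> I" "b j t = a i t" using Suc.prems(4) i j by metis
        then show ?thesis using j by (auto simp: K_def)
      qed simp
    qed
    moreover have fin: "finite (\<Union>t\<in>I. K t)" using Suc.prems by (auto simp: K_def)
    ultimately have "card J \<le> card (insert i (\<Union>t\<in>I. K t))" by (intro card_mono) auto
    also have "\<dots> \<le> Suc (card (\<Union>t\<in>I. K t))" by (rule card_insert_le_m1) auto
    also have "card (\<Union>t\<in>I. K t) \<le> (\<Sum>t\<in>I. card (K t))" using Suc.prems(1) by (rule card_UN_le)
    also have "\<dots> \<le> card I * cross_bound n" using sum_bounded_above[of I "\<lambda>t. card (K t)"] K by simp
    finally show ?thesis using Suc.hyps(2) by (metis Suc_le_mono cross_bound.simps(2))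
  qed simp
qed

text \<open>Adjacency means that \<open>k\<close> divides 3(i - j) - 2 or 3(i - j). For indices
  below \<open>k div 3\<close> both are smaller than \<open>k\<close> in absolute value, so the
  divisible one is 0; modulo 3 this cannot be the first.\<close>

lemma cyclic_adj_triple:
  assumes "i < k div 3" "j < k div 3"
  shows "cyclic_adj k (3 * i) (3 * j + 1) \<longleftrightarrow> i = j"
proof
  assume "cyclic_adj k (3 * i) (3 * j + 1)"
  then consider "int k dvd 3 * int i - 3 * int j - 2" | "int k dvd 3 * int i - 3 * int j"
    by (auto simp: cyclic_adj_def cong_iff_dvd_diff)
  moreover have lt: "3 * int i \<le> int k - 3" "3 * int j \<le> int k - 3" using assms by linarith+
  moreover have small: "x = 0" if "int k dvd x" "\<bar>x\<bar> < int k" for x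
    using that zdvd_not_zless[of "\<bar>x\<bar>" "int k"] by force
  ultimately show "i = j"
  proof cases
    case 1
    have "3 * int i - 3 * int j - 2 = 0" using small[OF 1] lt by linarith
    then show ?thesis by presburger
  next
    case 2
    have "3 * int i - 3 * int j = 0" using small[OF 2] lt by linarith
    then show ?thesis by simp
  qed
qed (simp add: cyclic_adj_def)

text \<open>The colour vectors at \<open>3 * i\<close> and \<open>3 * i + 1\<close> form a cross
  family of \<open>k div 3\<close> pairs; the final 2 is the largest remainder modulo 3.\<close>

lemma cycle_colouring_bounded:
  assumes c: "cycle_colouring k I c" and "finite I"
  shows "k \<le> 3 * cross_bound (card I) + 2"
proof -
  have "card {..<k div 3} \<le> cross_bound (card I)"
  proof (rule card_cross_family_le[where a = "\<lambda>i. c (3 * i)" and b = "\<lambda>i. c (3 * i + 1)"])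
    have *: "(\<forall>t\<in>I. c (3 * i) t \<noteq> c (3 * j + 1) t) \<longleftrightarrow> i = j"
      if "i < k div 3" "j < k div 3" for i j
    proof -
      have "3 * i < k" "3 * j + 1 < k" using that by linarith+
      then show ?thesis using c cyclic_adj_triple[OF that] unfolding cycle_colouring_def by simp
    qed
    show "c (3 * j) t \<noteq> c (3 * j + 1) t" if "j \<in> {..<k div 3}" "t \<in> I" for j t
      using *[of j j] that by simp
    show "\<exists>t\<in>I. c (3 * i) t = c (3 * j + 1) t"
      if "i \<in> {..<k div 3}" "j \<in> {..<k div 3}" "i \<noteq> j" for i j
      using *[of i j] that by auto
  qed (use assms in auto)
  then show ?thesis by simp
qed


section \<open>Complete multipartite graphs\<close>

text \<open>The colour of a vertex is the part containing it, unique because parts are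
  disjoint.\<close>

lemma complete_multipartite_colouring:
  assumes "complete_multipartite k G"
  obtains f :: "'v \<Rightarrow> 'v set"
    where "\<And>x y. x \<in> verts G \<Longrightarrow> y \<in> verts G \<Longrightarrow> adj G x y \<longleftrightarrow> f x \<noteq> f y"
proof -
  obtain P where P: "partition_on (verts G) P"
    and adj: "\<And>x y. x \<in> verts G \<Longrightarrow> y \<in> verts G \<Longrightarrow> adj G x y \<longleftrightarrow> \<not> (\<exists>p \<in> P. x \<in> p \<and> y \<in> p)"
    using assms unfolding complete_multipartite_def by blast
  define f where "f x = (THE p. p \<in> P \<and> x \<in> p)" for x
  have f: "p = f x" if "p \<in> P" "x \<in> p" for p x
    unfolding f_def using that partition_onD2[OF P]
    by (intro the_equality[symmetric]) (auto simp: disjoint_def)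
  have "f x \<in> P \<and> x \<in> f x" if "x \<in> verts G" for x
    using that f P unfolding partition_on_def by blast
  then have "adj G x y \<longleftrightarrow> f x \<noteq> f y" if "x \<in> verts G" "y \<in> verts G" for x y
    using adj[OF that] f that by metis
  then show ?thesis using that by blast
qed

text \<open>The parts are the fibres of \<open>f\<close> over its image, hence nonempty and one for
  each colour that occurs.\<close>

lemma complete_multipartite_of_colouring:
  assumes "finite V"
  shows "complete_multipartite (card (f ` V)) \<lparr>verts = V, adj = (\<lambda>x y. f x \<noteq> f y)\<rparr>"
proof -
  define P where "P = (\<lambda>c. {x \<in> V. f x = c}) ` f ` V"
  have "inj_on (\<lambda>c. {x \<in> V. f x = c}) (f ` V)" by (auto simp: inj_on_def)
  then have "card P = card (f ` V)" unfolding P_def by (rule card_image)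
  moreover have "partition_on V P"
    by (auto simp: partition_on_def disjoint_def P_def)
  moreover have "finite P" using assms by (simp add: P_def)
  moreover have "\<forall>x\<in>V. \<forall>y\<in>V. f x \<noteq> f y \<longleftrightarrow> \<not> (\<exists>p \<in> P. x \<in> p \<and> y \<in> p)"
    by (auto simp: P_def)
  ultimately show ?thesis unfolding complete_multipartite_def by auto
qed

text \<open>At coordinate \<open>t\<close> an index is coloured by the part of its vertex. Numeric
  colours with \<open>c i t \<le> i\<close> eliminate the vertex type and are residues modulo any
  prime exceeding \<open>k\<close>.\<close>

lemma mu_values_colouring:
  assumes "k \<in> mu_values TYPE('v) r"
  obtains c :: "nat \<Rightarrow> nat \<Rightarrow> nat"
  where "cycle_colouring k {..<r} c" "\<And>i t. c i t \<le> i"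
proof -
  obtain ks and Gs :: "'v graph list" and vs where r: "size (mset ks) = r"
    and cm: "list_all2 complete_multipartite ks Gs"
    and vs: "induced_cycle (conj_graph Gs) vs" and k: "k = length vs"
    using assms unfolding mu_values_def conj_class_def induced_cycle_lengths_def by blast
  have len: "length Gs = r" using r cm by (simp add: list_all2_lengthD)
  have "\<exists>f :: 'v \<Rightarrow> 'v set. \<forall>x\<in>verts (Gs ! t). \<forall>y\<in>verts (Gs ! t). adj (Gs ! t) x y \<longleftrightarrow> f x \<noteq> f y"
    if "t < r" for t
  proof -
    have "complete_multipartite (ks ! t) (Gs ! t)"
      using list_all2_nthD2[OF cm] that len by simp
    then show ?thesis by (rule complete_multipartite_colouring) blast
  qed
  then obtain f :: "nat \<Rightarrow> 'v \<Rightarrow> 'v set" where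
    f: "\<And>t x y. t < r \<Longrightarrow> x \<in> verts (Gs ! t) \<Longrightarrow> y \<in> verts (Gs ! t) \<Longrightarrow>
          adj (Gs ! t) x y \<longleftrightarrow> f t x \<noteq> f t y"
    by metis
  define g where "g i t = f t (vs ! i ! t)" for i t
  \<comment> \<open>A colour is renamed to the first index where it occurs, which preserves equality
    of colours and gives the bound.\<close>
  define c where "c i t = (LEAST j. g j t = g i t)" for i t
  have g: "g (c i t) t = g i t" for i t unfolding c_def by (rule LeastI) (rule refl)
  have cg: "c i t = c j t \<longleftrightarrow> g i t = g j t" for i j t
    using g by (metis c_def)
  have "cycle_colouring k {..<r} c"
    unfolding cycle_colouring_def
  proof (intro conjI allI impI)
    show "3 \<le> k" using vs k by (simp add: induced_cycle_iff)
    fix i j assume ij: "i < k" "j < k"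
    have mem: "vs ! i ! t \<in> verts (Gs ! t)" if "i < k" "t < r" for i t
    proof -
      have "vs ! i \<in> verts (conj_graph Gs)" using vs that k by (auto simp: induced_cycle_iff)
      then show ?thesis using that len by (simp add: conj_graph_def)
    qed
    have "(\<forall>t\<in>{..<r}. c i t \<noteq> c j t) \<longleftrightarrow> adj (conj_graph Gs) (vs ! i) (vs ! j)"
      using f mem ij by (simp add: conj_graph_def len cg g_def Ball_def)
    also have "\<dots> \<longleftrightarrow> cyclic_adj k i j" using vs ij k by (simp add: induced_cycle_iff)
    finally show "(\<forall>t\<in>{..<r}. c i t \<noteq> c j t) \<longleftrightarrow> cyclic_adj k i j" .
  qed
  moreover have "c i t \<le> i" for i t unfolding c_def by (rule Least_le) (rule refl)
  ultimately show ?thesis using that by blast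
qed


section \<open>Unitary Cayley graphs\<close>

lemma verts_unitary_cayley: "verts (unitary_cayley n) = {0..<int n}"
  by (auto simp: unitary_cayley_def cayley_graph_def residue_ring_def)

text \<open>The units modulo \<open>n\<close> are the residues coprime to \<open>n\<close>, and
  coprimality is tested prime by prime.\<close>

lemma adj_unitary_cayley:
  assumes "n > 1" "x \<in> {0..<int n}" "y \<in> {0..<int n}"
  shows "adj (unitary_cayley n) x y \<longleftrightarrow>
    (\<forall>p\<in>prime_factors n. x mod int p \<noteq> y mod int p)"
proof -
  interpret residues "int n" "residue_ring (int n)"
    by unfold_locales (use assms in auto)
  let ?R = "residue_ring (int n)"
  have "x \<ominus>\<^bsub>?R\<^esub> y = (x - y) mod int n"
    by (simp add: a_minus_def res_neg_eq res_add_eq mod_simps)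
  then have "adj (unitary_cayley n) x y \<longleftrightarrow> (x - y) mod int n \<in> Units ?R"
    by (simp add: unitary_cayley_def cayley_graph_def)
  also have "\<dots> \<longleftrightarrow> coprime (x - y) (int n)"
  proof -
    \<comment> \<open>\<open>res_units_eq\<close> describes units by positive representatives, so
      the residue 0 has to be excluded; this is where \<open>n > 1\<close> enters.\<close>
    have "(x - y) mod int n \<noteq> 0" if "coprime (x - y) (int n)"
    proof
      assume "(x - y) mod int n = 0"
      then have "int n dvd x - y" by (simp add: mod_eq_0_iff_dvd)
      then have "is_unit (int n)" using that by (meson coprime_common_divisor dvd_refl)
      then show False using assms(1) by simp
    qed
    moreover have "(x - y) mod int n \<ge> 0" "(x - y) mod int n < int n" using assms(1) by auto
    moreover have "coprime ((x - y) mod int n) (int n) \<longleftrightarrow> coprime (x - y) (int n)"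
      using assms(1) by simp
    ultimately show ?thesis unfolding res_units_eq mem_Collect_eq by linarith
  qed
  also have "\<dots> \<longleftrightarrow> (\<forall>p\<in>prime_factors n. \<not> int p dvd x - y)"
  proof
    assume c: "coprime (x - y) (int n)"
    show "\<forall>p\<in>prime_factors n. \<not> int p dvd x - y"
    proof (intro ballI notI)
      fix p assume p: "p \<in> prime_factors n" "int p dvd x - y"
      then have "int p dvd int n" by (simp add: in_prime_factors_iff)
      then have "is_unit (int p)" using c p by (meson coprime_common_divisor)
      then show False using p by (auto simp: in_prime_factors_iff)
    qed
  next
    assume p: "\<forall>p\<in>prime_factors n. \<not> int p dvd x - y"
    show "coprime (x - y) (int n)"
    proof (rule ccontr)
      assume "\<not> coprime (x - y) (int n)"
      moreover have "coprime (int (nat \<bar>x - y\<bar>)) (int n) \<longleftrightarrow> coprime (x - y) (int n)" by simp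
      ultimately have "gcd (nat \<bar>x - y\<bar>) n \<noteq> 1"
        by (metis coprime_int_iff coprime_iff_gcd_eq_1)
      then obtain q where q: "prime q" "q dvd gcd (nat \<bar>x - y\<bar>) n"
        using prime_factor_nat by blast
      have "q dvd nat \<bar>x - y\<bar>" "q dvd n"
        using dvd_trans[OF q(2) gcd_dvd1] dvd_trans[OF q(2) gcd_dvd2] by blast+
      then have "q \<in> prime_factors n" "int q dvd x - y"
        using q(1) assms(1) dvd_nat_abs_iff by (auto simp: in_prime_factors_iff)
      then show False using p by blast
    qed
  qed
  also have "\<dots> \<longleftrightarrow> (\<forall>p\<in>prime_factors n. x mod int p \<noteq> y mod int p)"
    unfolding mod_eq_dvd_iff ..
  finally show ?thesis .
qed

lemma induced_cycle_unitary_cayley_iff: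
  assumes "n > 1"
  shows "induced_cycle (unitary_cayley n) vs \<longleftrightarrow>
    distinct vs \<and> set vs \<subseteq> {0..<int n} \<and>
    cycle_colouring (length vs) (prime_factors n) (\<lambda>i p. vs ! i mod int p)"
proof -
  have "adj (unitary_cayley n) (vs ! i) (vs ! j) \<longleftrightarrow>
      (\<forall>p\<in>prime_factors n. vs ! i mod int p \<noteq> vs ! j mod int p)"
    if "set vs \<subseteq> {0..<int n}" "i < length vs" "j < length vs" for i j
    using that by (intro adj_unitary_cayley[OF assms]) (meson nth_mem subsetD)+
  then show ?thesis
    unfolding induced_cycle_iff cycle_colouring_def verts_unitary_cayley by blast
qed

text \<open>Colours below \<open>p\<close> are residues modulo \<open>p\<close>, so the Chinese
  remainder theorem yields a vertex with the prescribed colours.\<close>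

lemma cycle_in_unitary_cayley:
  assumes n: "n > 1" and c: "cycle_colouring k (prime_factors n) c" and k: "k \<ge> 5"
    and less: "\<And>i p. i < k \<Longrightarrow> p \<in> prime_factors n \<Longrightarrow> c i p < p"
  shows "k \<in> induced_cycle_lengths (unitary_cayley n)"
proof -
  have "\<exists>x. \<forall>p\<in>prime_factors n. [x = c i p] (mod p)" for i
    by (rule chinese_remainder_nat) (auto simp: in_prime_factors_iff primes_coprime)
  then obtain x where x: "\<And>i p. p \<in> prime_factors n \<Longrightarrow> [x i = c i p] (mod p)" by metis
  \<comment> \<open>Reduction modulo \<open>n\<close> moves the solutions into the vertex set and
    keeps their residues, because each \<open>p\<close> divides \<open>n\<close>.\<close>
  define vs where "vs = map (\<lambda>i. int (x i mod n)) [0..<k]"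
  have vs: "vs ! i mod int p = int (c i p)" if "i < k" "p \<in> prime_factors n" for i p
  proof -
    have "p dvd n" using that by (simp add: in_prime_factors_iff)
    then have "(x i mod n) mod p = c i p"
      using x[OF that(2), of i] less[OF that] by (simp add: mod_mod_cancel cong_def)
    then show ?thesis using that by (simp add: vs_def zmod_int[symmetric])
  qed
  have len: "length vs = k" by (simp add: vs_def)
  have cc: "cycle_colouring k (prime_factors n) (\<lambda>i p. vs ! i mod int p)"
    using c vs by (simp add: cycle_colouring_def)
  have "distinct vs"
    unfolding distinct_conv_nth len
    using cycle_colouring_distinct[OF cc k] by metis
  moreover have "set vs \<subseteq> {0..<int n}" using n by (auto simp: vs_def simp flip: of_nat_mod)
  ultimately have "induced_cycle (unitary_cayley n) vs"
    using induced_cycle_unitary_cayley_iff[OF n] cc len by simp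
  then show ?thesis using len unfolding induced_cycle_lengths_def by blast
qed

text \<open>The units modulo 6 are 1 and -1, so cyclic adjacency says that \<open>i - j\<close> is a
  unit, that is, nonzero modulo 2 and modulo 3.\<close>

lemma cyclic_adj_6:
  assumes "i < 6" "j < 6"
  shows "cyclic_adj 6 i j \<longleftrightarrow> i mod 2 \<noteq> j mod 2 \<and> i mod 3 \<noteq> j mod 3"
proof -
  have "i \<in> {0,1,2,3,4,5}" "j \<in> {0,1,2,3,4,5}" using assms by auto
  then show ?thesis by (auto simp: cyclic_adj_def cong_def)
qed

text \<open>The graph \<open>K\<^sub>2 \<and> K\<^sub>3\<close> is a 6-cycle.\<close>

lemma six_cycle_in_unitary_cayley:
  assumes n: "n > 1" and r: "card (prime_factors n) > 1"
  shows "6 \<in> induced_cycle_lengths (unitary_cayley n)"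
proof -
  \<comment> \<open>The smallest prime carries the colours modulo 2; every other prime is at least 3
    and has room for the colours modulo 3.\<close>
  define q where "q = Min (prime_factors n)"
  have ne: "prime_factors n \<noteq> {}" using r by auto
  have q: "q \<in> prime_factors n" unfolding q_def using ne by (intro Min_in) auto
  obtain q' where q': "q' \<in> prime_factors n" "q' \<noteq> q"
    using r q by (metis card_le_Suc0_iff_eq finite_set_mset not_le One_nat_def)
  have ge2: "p \<ge> 2" if "p \<in> prime_factors n" for p
    using that by (auto simp: in_prime_factors_iff prime_ge_2_nat)
  have ge3: "p \<ge> 3" if "p \<in> prime_factors n" "p \<noteq> q" for p
  proof -
    have "q \<le> p" using that by (simp add: q_def)
    then show ?thesis using that ge2[OF q] by simp
  qed
  show ?thesis
  proof (rule cycle_in_unitary_cayley[OF n])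
    let ?c = "\<lambda>i p. if p = q then i mod 2 else i mod 3 :: nat"
    have "(\<forall>p\<in>prime_factors n. ?c i p \<noteq> ?c j p) \<longleftrightarrow> i mod 2 \<noteq> j mod 2 \<and> i mod 3 \<noteq> j mod 3"
      for i j using q q' by auto
    then show "cycle_colouring 6 (prime_factors n) ?c"
      using cyclic_adj_6 by (simp add: cycle_colouring_def)
    show "?c i p < p" if "p \<in> prime_factors n" for i p
      using ge2[OF that] ge3[OF that] by (auto intro: order.strict_trans2[OF mod_less_divisor])
  qed simp
qed

lemma finite_induced_cycle_lengths:
  assumes "finite (verts G)"
  shows "finite (induced_cycle_lengths G)"
proof (rule finite_subset)
  show "induced_cycle_lengths G \<subseteq> {..card (verts G)}"
    using assms by (auto simp: induced_cycle_lengths_def induced_cycle_def)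
      (metis card_mono distinct_card)
qed simp


section \<open>Comparison\<close>

text \<open>Placing every vertex on the diagonal avoids decomposing \<open>\<int>\<^sub>n\<close> as a product.\<close>

lemma unitary_cayley_lengths_subset_mu_values:
  assumes n: "n > 1"
  shows "induced_cycle_lengths (unitary_cayley n)
    \<subseteq> mu_values TYPE('v::infinite) (card (prime_factors n))"
proof
  fix k assume "k \<in> induced_cycle_lengths (unitary_cayley n)"
  then obtain vs where vs: "induced_cycle (unitary_cayley n) vs" and k: "k = length vs"
    unfolding induced_cycle_lengths_def by blast
  \<comment> \<open>The vertex type is only known to be infinite, so the integers are injected into
    it.\<close>
  obtain h :: "nat \<Rightarrow> 'v" where h: "inj h"
    using infinite_countable_subset[OF infinite_UNIV] by auto
  define e where "e = h \<circ> (to_nat :: int \<Rightarrow> nat)"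
  have e: "inj e" unfolding e_def by (intro inj_compose h) simp
  obtain ps where ps: "set ps = prime_factors n" "distinct ps"
    using finite_distinct_list[of "prime_factors n"] by auto
  define V where "V = e ` {0..<int n}"
  define f where "f p x = inv_into UNIV e x mod int p" for p x
  define Gs where "Gs = map (\<lambda>p. \<lparr>verts = V, adj = (\<lambda>x y. f p x \<noteq> f p y)\<rparr>) ps"
  define ks where "ks = map (\<lambda>p. card (f p ` V)) ps"
  define us where "us = map (\<lambda>x. replicate (length ps) (e x)) vs"
  have finV: "finite V" and neV: "V \<noteq> {}" using n by (auto simp: V_def)
  have cm: "list_all2 complete_multipartite ks Gs"
    using finV by (auto simp: list_all2_conv_all_nth ks_def Gs_def
        intro: complete_multipartite_of_colouring)
  \<comment> \<open>At least one coordinate is needed for the diagonal map to be injective.\<close>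
  have "ps \<noteq> []"
  proof
    assume "ps = []"
    then have "prime_factors n = {}" using ps by simp
    then show False using n by (metis prime_factorization_empty_iff set_mset_eq_empty_iff
        less_numeral_extra(4) not_one_less_zero nat_dvd_1_iff_1)
  qed
  have vs': "distinct vs" "set vs \<subseteq> {0..<int n}"
    "cycle_colouring (length vs) (prime_factors n) (\<lambda>i p. vs ! i mod int p)"
    using vs induced_cycle_unitary_cayley_iff[OF n] by auto
  have "induced_cycle (conj_graph Gs) us"
    unfolding induced_cycle_iff
  proof (intro conjI allI impI)
    show "3 \<le> length us" using vs by (simp add: us_def induced_cycle_iff)
    have "inj (\<lambda>x. replicate (length ps) (e x))"
      using e \<open>ps \<noteq> []\<close> by (auto simp: inj_def)
    then show "distinct us" unfolding us_def
      using vs'(1) by (simp add: distinct_map inj_on_def inj_def)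
    show "set us \<subseteq> verts (conj_graph Gs)"
      using vs'(2) by (auto simp: us_def conj_graph_def Gs_def V_def)
    fix i j assume ij: "i < length us" "j < length us"
    have "adj (conj_graph Gs) (us ! i) (us ! j) \<longleftrightarrow>
        (\<forall>t<length ps. vs ! i mod int (ps ! t) \<noteq> vs ! j mod int (ps ! t))"
      using ij e by (simp add: conj_graph_def Gs_def us_def f_def)
    also have "\<dots> \<longleftrightarrow> (\<forall>p\<in>prime_factors n. vs ! i mod int p \<noteq> vs ! j mod int p)"
      unfolding ps(1)[symmetric] by (simp add: all_set_conv_all_nth)
    also have "\<dots> \<longleftrightarrow> cyclic_adj (length us) i j"
      using vs'(3) ij by (simp add: cycle_colouring_def us_def)
    finally show "adj (conj_graph Gs) (us ! i) (us ! j) \<longleftrightarrow> cyclic_adj (length us) i j" .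
  qed
  then have "k \<in> induced_cycle_lengths (conj_graph Gs)"
    unfolding induced_cycle_lengths_def k us_def by force
  moreover have "conj_graph Gs \<in> conj_class (mset ks)"
    unfolding conj_class_def using cm by blast
  moreover have "size (mset ks) = card (prime_factors n)"
    using distinct_card[OF ps(2)] ps(1) by (simp add: ks_def)
  moreover have "\<forall>k\<in>#mset ks. k > 0"
    using finV neV by (auto simp: ks_def card_gt_0_iff)
  ultimately show "k \<in> mu_values TYPE('v) (card (prime_factors n))"
    unfolding mu_values_def by blast
qed

text \<open>The bound on colourings depends on \<open>r\<close> alone, so it is uniform over all
  conjunctions, infinite ones included.\<close>

lemma finite_mu_values: "finite (mu_values TYPE('v) r)"
proof (rule finite_subset)
  show "mu_values TYPE('v) r \<subseteq> {..3 * cross_bound r + 2}"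
  proof
    fix k assume "k \<in> mu_values TYPE('v) r"
    then obtain c :: "nat \<Rightarrow> nat \<Rightarrow> nat" where "cycle_colouring k {..<r} c"
      by (rule mu_values_colouring)
    from cycle_colouring_bounded[OF this] show "k \<in> {..3 * cross_bound r + 2}" by simp
  qed
qed simp

text \<open>The witness is a product of \<open>r\<close> distinct primes beyond \<open>N\<close>;
  large primes provide enough residues for the colours.\<close>

lemma exists_card_prime_factors:
  "\<exists>n :: nat > 0. card (prime_factors n) = r \<and> (\<forall>p\<in>prime_factors n. p > N)"
proof -
  have "infinite ({p :: nat. prime p} - {..N})" using primes_infinite by (intro Diff_infinite_finite) auto
  then obtain P where P: "finite P" "card P = r" "P \<subseteq> {p. prime p} - {..N}"
    using infinite_arbitrarily_large by metis
  have "prime_factorization (\<Prod>P) = mset_set P"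
    using P by (auto simp: prod_unfold_prod_mset intro!: prime_factorization_prod_mset_primes)
  then have "prime_factors (\<Prod>P) = P" using P by simp
  moreover have "\<Prod>P > 0" using P by (auto intro!: prod_pos prime_gt_0_nat)
  ultimately show ?thesis using P by (intro exI[of _ "\<Prod>P"]) auto
qed

lemma mu_values_attained_by_unitary_cayley:
  assumes "k \<in> mu_values TYPE('v) r" "k \<ge> 5" "r > 1"
  shows "\<exists>n>0. card (prime_factors n) = r \<and> k \<in> induced_cycle_lengths (unitary_cayley n)"
proof -
  obtain c :: "nat \<Rightarrow> nat \<Rightarrow> nat"
    where c: "cycle_colouring k {..<r} c" and less: "\<And>i t. c i t \<le> i"
    using mu_values_colouring[OF assms(1)] by blast
  obtain n :: nat where n: "n > 0" "card (prime_factors n) = r"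
    and big: "\<And>p. p \<in> prime_factors n \<Longrightarrow> p > k"
    using exists_card_prime_factors[of r k] by auto
  have "n > 1" using n assms(3) by (cases "n = 1") auto
  \<comment> \<open>Primes are matched with coordinates; the colours fit because
    \<open>c i t \<le> i\<close>, \<open>i < k\<close> and \<open>k < p\<close>.\<close>
  obtain b where b: "bij_betw b (prime_factors n) {..<r}"
    using n(2) by (metis bij_betw_iff_card finite_set_mset finite_lessThan card_lessThan)
  have "cycle_colouring k (prime_factors n) (\<lambda>i p. c i (b p))"
    using c unfolding cycle_colouring_def bij_betw_imp_surj_on[OF b, symmetric] by simp
  then have "k \<in> induced_cycle_lengths (unitary_cayley n)"
    using \<open>n > 1\<close> assms(2) le_less_trans[OF less less_trans[OF _ big]]
    by (intro cycle_in_unitary_cayley)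
  then show ?thesis using n by blast
qed

theorem theorem4p2:
  fixes r :: nat
  assumes "r > 1"
  shows "(\<forall>n > 0. card (prime_factors n) = r \<longrightarrow>
            has_max (induced_cycle_lengths (unitary_cayley n))) \<and>
         has_max (m_values r) \<and>
         has_max (mu_values TYPE('v::infinite) r) \<and>
         mu TYPE('v) r = m_fun r"
proof -
  let ?mu = "mu_values TYPE('v) r"
  have n1: "n > 1" if "n > 0" "card (prime_factors n) = r" for n :: nat
    using that assms by (cases "n = 1") auto
  \<comment> \<open>The 6-cycle makes every set of lengths nonempty and lifts \<open>mu\<close>
    above the threshold 5 required for realisation in a unitary Cayley graph.\<close>
  have six: "6 \<in> induced_cycle_lengths (unitary_cayley n)"
    if "n > 0" "card (prime_factors n) = r" for n
    using six_cycle_in_unitary_cayley n1[OF that] that assms by simp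
  have fin: "finite (induced_cycle_lengths (unitary_cayley n))" for n
    by (rule finite_induced_cycle_lengths) (simp add: verts_unitary_cayley)
  have sub: "induced_cycle_lengths (unitary_cayley n) \<subseteq> ?mu"
    if "n > 0" "card (prime_factors n) = r" for n
    using unitary_cayley_lengths_subset_mu_values[OF n1[OF that]] that by simp
  \<comment> \<open>Each maximum is itself a cycle length of a conjunction, so
    \<open>m_values r\<close> inherits finiteness although \<open>n\<close> ranges over infinitely
    many numbers.\<close>
  have "M_fun n \<in> ?mu" if "n > 0" "card (prime_factors n) = r" for n
    using sub[OF that] Max_in[OF fin] six[OF that] unfolding M_fun_def by blast
  then have m_sub: "m_values r \<subseteq> ?mu" unfolding m_values_def by blast
  then have fin_m: "finite (m_values r)" using finite_mu_values finite_subset by blast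
  obtain n :: nat where n: "n > 0" "card (prime_factors n) = r"
    using exists_card_prime_factors by blast
  then have ne_m: "m_values r \<noteq> {}" unfolding m_values_def by blast
  have 6: "6 \<in> ?mu" using six[OF n] sub[OF n] by blast
  have "mu TYPE('v) r \<in> ?mu" "mu TYPE('v) r \<ge> 6"
    unfolding mu_def using 6 Max_in[OF finite_mu_values] Max_ge[OF finite_mu_values 6] by auto
  then obtain n' where n': "n' > 0" "card (prime_factors n') = r"
    and "mu TYPE('v) r \<in> induced_cycle_lengths (unitary_cayley n')"
    using mu_values_attained_by_unitary_cayley[of "mu TYPE('v) r"] assms by force
  then have "mu TYPE('v) r \<le> M_fun n'" unfolding M_fun_def using fin by simp
  also have "M_fun n' \<le> m_fun r"
    unfolding m_fun_def using fin_m n' by (intro Max_ge) (auto simp: m_values_def)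
  finally have "mu TYPE('v) r \<le> m_fun r" .
  moreover have "m_fun r \<le> mu TYPE('v) r"
    unfolding m_fun_def mu_def by (rule Max_mono[OF m_sub ne_m finite_mu_values])
  ultimately show ?thesis
    using six fin fin_m ne_m 6 finite_mu_values[where 'v = 'v] unfolding has_max_def by auto
qed

end
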